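(* (i) If $A\in\mathbb{C}^{m\times m}$ is nonsingular and $B\in\mathbb{C}^{m\times n}$, then $$\frac{\operatorname{sr}(B)}{\kappa_2(A)^2} \le \operatorname{sr}(AB) \le \kappa_2(A)^2\,\operatorname{sr}(B).$$ (ii) If $A\in\mathbb{C}^{n\times n}$ is Hermitian positive definite, $B\in\mathbb{C}^{n\times n}$ is Hermitian positive semi-definite, and the product $AB$ is Hermitian positive semi-definite (so that $\operatorname{intdim}(AB)$ is defined), then $$\frac{\operatorname{intdim}(B)}{\kappa_2(A)} \le \operatorname{intdim}(AB) \le \kappa_2(A)\,\operatorname{intdim}(B).$$
   Context: $\|A\|_2$ is the operator two-norm (largest singular value) and $\|A\|_F$ the Frobenius norm. The stable rank of a non-zero matrix $A\in\mathbb{C}^{m\times n}$ is $\operatorname{sr}(A)=\|A\|_F^2/\|A\|_2^2$, and $\operatorname{sr}(0)=0$. The intrinsic dimension of a non-zero Hermitian positive semi-definite matrix $A$ is $\operatorname{intdim}(A)=\operatorname{trace}(A)/\|A\|_2$, and $\operatorname{intdim}(0)=0$. For a nonsingular square matrix $A$, $\kappa_2(A)=\|A\|_2\|A^{-1}\|_2$ is the two-norm condition number. *)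

theory Defs
  imports "HOL-Analysis.Analysis"
begin

text \<open>
  An $m \times n$ complex matrix is an element of \<^typ>\<open>complex^'n^'m\<close>; the norm on
  \<^typ>\<open>complex^'n\<close> is the Euclidean norm, so \<^const>\<open>onorm\<close> below is taken with respect to the
  two-norm on both sides. It is computed over the reals as scalars, which does not affect
  the supremum of the quotients.
\<close>

definition two_norm :: "complex^'n^'m \<Rightarrow> real" where
  "two_norm A = onorm (\<lambda>x. A *v x)"

definition frobenius_norm :: "complex^'n^'m \<Rightarrow> real" where
  "frobenius_norm A = sqrt (\<Sum>i\<in>UNIV. \<Sum>j\<in>UNIV. (cmod (A $ i $ j))\<^sup>2)"

definition stable_rank :: "complex^'n^'m \<Rightarrow> real" where
  "stable_rank A = (if A = 0 then 0 else (frobenius_norm A)\<^sup>2 / (two_norm A)\<^sup>2)"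

definition hermitian :: "complex^'n^'n \<Rightarrow> bool" where
  "hermitian A \<longleftrightarrow> (\<forall>i j. A $ i $ j = cnj (A $ j $ i))"

text \<open>The quadratic form $x^* A x$. For Hermitian \<open>A\<close> it is real, so that only its real part is
  compared with 0 in the two definitions that follow.\<close>

definition quad_form :: "complex^'n^'n \<Rightarrow> complex^'n \<Rightarrow> complex" where
  "quad_form A x = (\<Sum>i\<in>UNIV. cnj (x $ i) * (A *v x) $ i)"

definition hermitian_psd :: "complex^'n^'n \<Rightarrow> bool" where
  "hermitian_psd A \<longleftrightarrow> hermitian A \<and> (\<forall>x. 0 \<le> Re (quad_form A x))"

definition hermitian_pd :: "complex^'n^'n \<Rightarrow> bool" where
  "hermitian_pd A \<longleftrightarrow> hermitian A \<and> (\<forall>x. x \<noteq> 0 \<longrightarrow> 0 < Re (quad_form A x))"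

text \<open>Only meaningful for Hermitian positive semi-definite \<open>A\<close>; the trace is then real.\<close>

definition intdim :: "complex^'n^'n \<Rightarrow> real" where
  "intdim A = (if A = 0 then 0 else Re (trace A) / two_norm A)"

text \<open>Only meaningful for invertible \<open>A\<close>.\<close>

definition cond2 :: "complex^'n^'n \<Rightarrow> real" where
  "cond2 A = two_norm A * two_norm (matrix_inv A)"

end

theory Submission
  imports Defs
begin

text \<open>
  Both upper bounds divide an estimate of the numerator by
  $\|B\|_2 \le \|A^{-1}\|_2 \|AB\|_2$: for the stable rank, $\|AB\|_F \le \|A\|_2 \|B\|_F$; for the
  intrinsic dimension, $\mathrm{Re}\,\mathrm{tr}(AB) \le \|A\|_2\,\mathrm{tr}(B)$ for positive
  semi-definite $B$ and arbitrary $A$. The latter is clear for $B = vv^*$, and a positive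
  semi-definite $B$ is a sum of such terms, obtained by Cholesky elimination of one row after the
  other. The lower bounds are the upper bounds for the factors $A^{-1}$ and $AB$, since
  $\kappa_2(A^{-1}) = \kappa_2(A)$.
\<close>

section \<open>Operator norm and Frobenius norm\<close>

lemma norm_mult_vec_le:
  fixes A :: "complex^'n^'m"
  shows "norm (A *v x) \<le> two_norm A * norm x"
  unfolding two_norm_def by (rule onorm[OF matrix_vector_mul_bounded_linear])

lemma two_norm_nonneg: "0 \<le> two_norm (A :: complex^'n^'m)"
  unfolding two_norm_def by (rule onorm_pos_le[OF matrix_vector_mul_bounded_linear])

lemma two_norm_eq_0_iff:
  fixes A :: "complex^'n^'m"
  shows "two_norm A = 0 \<longleftrightarrow> A = 0"
  unfolding two_norm_def onorm_eq_0[OF matrix_vector_mul_bounded_linear]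
  by (metis matrix_eq matrix_vector_mult_0)

lemma two_norm_pos: "A \<noteq> 0 \<Longrightarrow> 0 < two_norm (A :: complex^'n^'m)"
  using two_norm_nonneg[of A] two_norm_eq_0_iff[of A] by linarith

lemma two_norm_mult_le:
  fixes A :: "complex^'n^'m" and B :: "complex^'k^'n"
  shows "two_norm (A ** B) \<le> two_norm A * two_norm B"
  using onorm_compose[OF matrix_vector_mul_bounded_linear[of A] matrix_vector_mul_bounded_linear[of B]]
  by (simp add: two_norm_def o_def matrix_vector_mul_assoc)

lemma norm_vec_power2:
  fixes x :: "complex^'n"
  shows "(norm x)\<^sup>2 = (\<Sum>i\<in>UNIV. (cmod (x $ i))\<^sup>2)"
  by (simp add: norm_vec_def L2_set_def sum_nonneg)

text \<open>Grouping the squared entries by columns suits left multiplication, which acts on each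
  column separately.\<close>

lemma frobenius_norm_power2:
  fixes A :: "complex^'n^'m"
  shows "(frobenius_norm A)\<^sup>2 = (\<Sum>j\<in>UNIV. (norm (column j A))\<^sup>2)"
proof -
  have "(frobenius_norm A)\<^sup>2 = (\<Sum>i\<in>UNIV. \<Sum>j\<in>UNIV. (cmod (A $ i $ j))\<^sup>2)"
    by (simp add: frobenius_norm_def sum_nonneg)
  also have "\<dots> = (\<Sum>j\<in>UNIV. \<Sum>i\<in>UNIV. (cmod (A $ i $ j))\<^sup>2)"
    by (rule sum.swap)
  finally show ?thesis
    by (simp add: norm_vec_power2 column_def)
qed

lemma column_matrix_mult: "column j (A ** B) = A *v column j B"
  by (simp add: column_def vec_eq_iff matrix_matrix_mult_def matrix_vector_mult_def)

text \<open>Column \<open>j\<close> of \<open>A ** B\<close> is \<open>A\<close> applied to column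
  \<open>j\<close> of \<open>B\<close>, so every column norm grows at most by the factor
  \<open>two_norm A\<close>; the squares are then summed.\<close>

lemma frobenius_norm_mult_le:
  fixes A :: "complex^'n^'m" and B :: "complex^'k^'n"
  shows "(frobenius_norm (A ** B))\<^sup>2 \<le> (two_norm A)\<^sup>2 * (frobenius_norm B)\<^sup>2"
proof -
  have "(norm (A *v x))\<^sup>2 \<le> (two_norm A)\<^sup>2 * (norm x)\<^sup>2" for x
    using power_mono[OF norm_mult_vec_le[of A x] norm_ge_zero, of 2]
    by (simp add: power_mult_distrib)
  then show ?thesis
    by (simp add: frobenius_norm_power2 column_matrix_mult sum_distrib_left sum_mono)
qed

section \<open>The trace of a product with a positive semi-definite factor\<close>

lemma hermitian_vec_mult:
  assumes "hermitian B"
  shows "(\<Sum>k\<in>UNIV. cnj (x $ k) * B $ k $ i) = cnj ((B *v x) $ i)"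
  unfolding matrix_vector_mult_def vec_lambda_beta cnj_sum
proof (rule sum.cong[OF refl])
  fix k
  have "B $ k $ i = cnj (B $ i $ k)"
    using assms unfolding hermitian_def by blast
  then show "cnj (x $ k) * B $ k $ i = cnj (B $ i $ k * x $ k)"
    by simp
qed

lemma hermitian_diag:
  assumes "hermitian B"
  shows "B $ i $ i = of_real (Re (B $ i $ i))"
proof -
  have "B $ i $ i = cnj (B $ i $ i)"
    using assms unfolding hermitian_def by blast
  then show ?thesis
    by (simp add: complex_eq_iff)
qed

text \<open>The two cross terms are conjugate to each other because \<open>B\<close> is Hermitian,
  which gives the factor 2 on the real part; the last coefficient is real because diagonal entries
  are.\<close>

lemma quad_form_add_axis:
  fixes B :: "complex^'n^'n"
  assumes "hermitian B"
  shows "Re (quad_form B (x + axis i t)) =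
    Re (quad_form B x) + 2 * Re (cnj t * (B *v x) $ i) + (cmod t)\<^sup>2 * Re (B $ i $ i)"
proof -
  have col: "(B *v axis i t) $ k = B $ k $ i * t" for k
    by (simp add: matrix_vector_mult_def axis_def if_distrib cong: if_cong)
  have ax: "(\<Sum>k\<in>UNIV. cnj (axis i t $ k) * f k) = cnj t * f i" for f :: "'n \<Rightarrow> complex"
    by (simp add: axis_def if_distrib if_distribR cong: if_cong)
  have "(\<Sum>k\<in>UNIV. cnj (x $ k) * (B $ k $ i * t)) = cnj ((B *v x) $ i) * t"
    unfolding hermitian_vec_mult[OF assms, symmetric] by (simp add: sum_distrib_right mult.assoc)
  then have "quad_form B (x + axis i t) =
      quad_form B x + cnj ((B *v x) $ i) * t + cnj t * (B *v x) $ i + cnj t * (B $ i $ i * t)"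
    by (simp add: quad_form_def matrix_vector_right_distrib col ring_distribs sum.distrib ax)
  moreover have "cnj t * (B $ i $ i * t) = of_real ((cmod t)\<^sup>2 * Re (B $ i $ i))"
    by (subst hermitian_diag[OF assms]) (simp add: complex_norm_square mult_ac del: of_real_power)
  moreover have "Re (cnj ((B *v x) $ i) * t) = Re (cnj t * (B *v x) $ i)"
    by (simp add: mult.commute)
  ultimately show ?thesis
    by simp
qed

lemma hermitian_psd_diag_nonneg:
  fixes B :: "complex^'n^'n"
  assumes "hermitian_psd B"
  shows "0 \<le> Re (B $ i $ i)"
proof -
  \<comment> \<open>The diagonal entry is the form at the unit vector, written as
    \<open>0 + axis i 1\<close> so that the expansion applies.\<close>
  have "Re (quad_form B (0 + axis i 1)) = Re (B $ i $ i)"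
    using assms
    by (subst quad_form_add_axis) (simp_all add: hermitian_psd_def quad_form_def)
  then show ?thesis
    using assms unfolding hermitian_psd_def by metis
qed

lemma hermitian_psd_trace_nonneg: "hermitian_psd B \<Longrightarrow> 0 \<le> Re (trace B)"
  unfolding trace_def Re_sum by (intro sum_nonneg hermitian_psd_diag_nonneg)

text \<open>The quadratic form at $x + t e_i$ is minimal for $t = -(Bx)_i / B_{ii}$; if $B_{ii} = 0$, it is
  evaluated at a large negative multiple $t$ of $(Bx)_i$ instead.\<close>

lemma hermitian_psd_schur:
  fixes B :: "complex^'n^'n"
  assumes "hermitian_psd B"
  shows "(cmod ((B *v x) $ i))\<^sup>2 \<le> Re (B $ i $ i) * Re (quad_form B x)"
proof -
  define w where "w = (B *v x) $ i"
  define b where "b = Re (B $ i $ i)"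
  define q where "q = Re (quad_form B x)"
  have herm: "hermitian B" and psd: "0 \<le> Re (quad_form B y)" for y
    using assms by (auto simp: hermitian_psd_def)
  \<comment> \<open>Taking \<open>t = - s * w\<close> with real \<open>s\<close> aligns the phase of
    the cross term and leaves a real quadratic polynomial in \<open>s\<close>.\<close>
  have *: "0 \<le> q - 2 * s * (cmod w)\<^sup>2 + s\<^sup>2 * (cmod w)\<^sup>2 * b" for s :: real
  proof -
    let ?t = "- of_real s * w"
    have "Re (cnj ?t * w) = - s * (cmod w)\<^sup>2"
      unfolding cmod_power2 by (simp add: power2_eq_square algebra_simps)
    moreover have "(cmod ?t)\<^sup>2 = s\<^sup>2 * (cmod w)\<^sup>2"
      by (simp add: norm_mult power_mult_distrib)
    ultimately show ?thesis
      using psd[of "x + axis i ?t"]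
      unfolding quad_form_add_axis[OF herm] w_def[symmetric] b_def[symmetric] q_def[symmetric]
      by simp
  qed
  have "0 \<le> b"
    unfolding b_def by (rule hermitian_psd_diag_nonneg[OF assms])
  have "(cmod w)\<^sup>2 \<le> b * q"
  proof (cases "b = 0")
    case True
    have "cmod w = 0"
    proof (rule ccontr)
      assume "cmod w \<noteq> 0"
      \<comment> \<open>With \<open>b = 0\<close>, this value of \<open>s\<close> turns the
        inequality into \<open>0 \<le> - q - 2\<close>, whereas \<open>s = 0\<close> gives
        \<open>0 \<le> q\<close>.\<close>
      then have "(q + 1) / (cmod w)\<^sup>2 * (cmod w)\<^sup>2 = q + 1"
        by simp
      then show False
        using *[of "(q + 1) / (cmod w)\<^sup>2"] *[of 0] True by (simp only: mult.assoc) simp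
    qed
    then show ?thesis
      using True by simp
  next
    case False
    then show ?thesis
      using *[of "1 / b"] \<open>0 \<le> b\<close> by (simp add: field_simps power2_eq_square)
  qed
  then show ?thesis
    by (simp add: w_def b_def q_def)
qed

text \<open>The inequality above at the unit vector \<open>axis j 1\<close> bounds the squared
  modulus of \<open>B $ i $ j\<close> by a multiple of the vanishing diagonal entry.\<close>

lemma hermitian_psd_zero_row:
  fixes B :: "complex^'n^'n"
  assumes "hermitian_psd B" "Re (B $ i $ i) = 0"
  shows "B $ i $ j = 0"
proof -
  have "(B *v axis j 1) $ i = 0"
    using hermitian_psd_schur[OF assms(1), of "axis j 1" i] assms(2) by simp
  then show ?thesis
    by (simp add: matrix_vector_mult_def axis_def if_distrib cong: if_cong)
qed

text \<open>For $B_{ii} = 0$ this is 0 because of $x / 0 = 0$, which is correct: row \<open>i\<close> then vanishes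
  already.\<close>

definition pivot_term :: "'n \<Rightarrow> complex^'n^'n \<Rightarrow> complex^'n^'n" where
  "pivot_term i B = (\<chi> k l. B $ k $ i * cnj (B $ l $ i) / of_real (Re (B $ i $ i)))"

text \<open>The form of the pivot term at \<open>x\<close> is the squared modulus of
  \<open>(B *v x) $ i\<close> divided by the pivot, so subtracting it keeps the form nonnegative
  exactly by \<open>hermitian_psd_schur\<close>.\<close>

lemma hermitian_psd_minus_pivot_term:
  fixes B :: "complex^'n^'n"
  assumes "hermitian_psd B"
  shows "hermitian_psd (B - pivot_term i B)"
proof -
  let ?b = "Re (B $ i $ i)"
  have herm: "hermitian B" and psd: "0 \<le> Re (quad_form B y)" for y
    using assms by (auto simp: hermitian_psd_def)
  have "hermitian (B - pivot_term i B)"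
    unfolding hermitian_def
  proof (intro allI)
    fix k l
    have "B $ k $ l = cnj (B $ l $ k)"
      using herm unfolding hermitian_def by blast
    then show "(B - pivot_term i B) $ k $ l = cnj ((B - pivot_term i B) $ l $ k)"
      by (simp add: pivot_term_def mult.commute)
  qed
  moreover have "0 \<le> Re (quad_form (B - pivot_term i B) x)" for x
  proof -
    let ?w = "(B *v x) $ i"
    have cs: "(\<Sum>l\<in>UNIV. cnj (B $ l $ i) * x $ l) = ?w"
    proof -
      have "(\<Sum>l\<in>UNIV. cnj (B $ l $ i) * x $ l) = cnj (\<Sum>l\<in>UNIV. cnj (x $ l) * B $ l $ i)"
        by (simp add: mult.commute)
      then show ?thesis
        by (simp only: hermitian_vec_mult[OF herm] complex_cnj_cnj)
    qed
    have "(pivot_term i B *v x) $ k = B $ k $ i * ?w / ?b" for k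
      unfolding cs[symmetric]
      by (simp add: matrix_vector_mult_def pivot_term_def sum_distrib_left sum_divide_distrib mult.assoc)
    then have "quad_form (pivot_term i B) x = (\<Sum>k\<in>UNIV. cnj (x $ k) * B $ k $ i) * ?w / ?b"
      by (simp add: quad_form_def sum_distrib_right sum_divide_distrib mult.assoc)
    also have "\<dots> = of_real ((cmod ?w)\<^sup>2 / ?b)"
      unfolding of_real_divide complex_norm_square
      by (simp add: hermitian_vec_mult[OF herm] mult.commute)
    finally have "quad_form (B - pivot_term i B) x = quad_form B x - of_real ((cmod ?w)\<^sup>2 / ?b)"
      by (simp add: quad_form_def matrix_vector_mult_diff_rdistrib right_diff_distrib sum_subtractf)
    \<comment> \<open>For a zero pivot the quotient is 0 by convention, and the claim is the
      nonnegativity of the form of \<open>B\<close> itself.\<close>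
    moreover have "(cmod ?w)\<^sup>2 / ?b \<le> Re (quad_form B x)"
      using hermitian_psd_schur[OF assms, of x i] hermitian_psd_diag_nonneg[OF assms, of i] psd[of x]
      by (cases "?b = 0") (simp_all add: field_simps)
    ultimately show ?thesis
      by simp
  qed
  ultimately show ?thesis
    by (simp add: hermitian_psd_def)
qed

text \<open>In row \<open>i\<close> of the pivot term the factor \<open>B $ i $ i\<close> cancels
  against the denominator, which leaves row \<open>i\<close> of \<open>B\<close>. If the pivot is 0,
  that row is already zero.\<close>

lemma minus_pivot_term_row:
  fixes B :: "complex^'n^'n"
  assumes "hermitian_psd B"
  shows "(B - pivot_term i B) $ i $ l = 0"
proof (cases "Re (B $ i $ i) = 0")
  case True
  then show ?thesis
    using hermitian_psd_zero_row[OF assms] by (simp add: pivot_term_def)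
next
  case False
  have herm: "hermitian B"
    using assms by (simp add: hermitian_psd_def)
  then have "B $ i $ l = cnj (B $ l $ i)"
    unfolding hermitian_def by blast
  moreover have "B $ i $ i * z / of_real (Re (B $ i $ i)) = z" for z
    by (subst hermitian_diag[OF herm]) (simp add: False)
  ultimately show ?thesis
    by (simp add: pivot_term_def)
qed

section \<open>Bounding the trace of the product, one eliminated row at a time\<close>

lemma Re_inner_mult_le:
  fixes A :: "complex^'n^'n"
  shows "Re (\<Sum>k\<in>UNIV. (A *v v) $ k * cnj (v $ k)) \<le> two_norm A * (norm v)\<^sup>2"
proof -
  \<comment> \<open>On complex vectors \<open>inner\<close> is the real part of the Hermitian inner
    product, so the real Cauchy-Schwarz inequality suffices.\<close>
  have "Re (\<Sum>k\<in>UNIV. (A *v v) $ k * cnj (v $ k)) = (A *v v) \<bullet> v"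
    by (simp add: inner_vec_def inner_complex_def)
  also have "\<dots> \<le> norm (A *v v) * norm v"
    by (rule norm_cauchy_schwarz)
  also have "\<dots> \<le> two_norm A * norm v * norm v"
    by (intro mult_right_mono norm_mult_vec_le norm_ge_zero)
  finally show ?thesis
    by (simp add: power2_eq_square mult.assoc)
qed

text \<open>With \<open>v = column i B\<close>, the pivot term is the rank-one matrix
  \<open>v v^*\<close> over the pivot, and the trace of \<open>A v v^*\<close> is
  \<open>v^* A v\<close>. A zero pivot makes both sides 0.\<close>

lemma trace_mult_pivot_term_le:
  fixes A B :: "complex^'n^'n"
  assumes "hermitian_psd B"
  shows "Re (trace (A ** pivot_term i B)) \<le> two_norm A * Re (trace (pivot_term i B))"
proof -
  let ?v = "column i B" and ?b = "Re (B $ i $ i)"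
  have "trace (A ** pivot_term i B) = (\<Sum>k\<in>UNIV. (A *v ?v) $ k * cnj (?v $ k)) / ?b"
    by (simp add: trace_def matrix_matrix_mult_def matrix_vector_mult_def pivot_term_def
        column_def sum_divide_distrib sum_distrib_right mult.assoc)
  moreover have "trace (pivot_term i B) = of_real ((norm ?v)\<^sup>2 / ?b)"
    unfolding of_real_divide norm_vec_power2 of_real_sum complex_norm_square
    by (simp add: trace_def pivot_term_def column_def sum_divide_distrib)
  ultimately show ?thesis
    using divide_right_mono[OF Re_inner_mult_le[of A ?v] hermitian_psd_diag_nonneg[OF assms, of i]]
    by simp
qed

lemma trace_mult_hermitian_psd_le:
  fixes A B :: "complex^'n^'n"
  assumes "hermitian_psd B"
  shows "Re (trace (A ** B)) \<le> two_norm A * Re (trace B)"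
proof -
  \<comment> \<open>Induction on a set \<open>S\<close> containing the indices of all nonzero rows.
    Eliminating row \<open>i\<close> leaves a positive semi-definite remainder with nonzero rows in
    a smaller set; both sides are linear in \<open>B\<close>, so the bounds for the remainder and
    the pivot term add up.\<close>
  have "Re (trace (A ** B)) \<le> two_norm A * Re (trace B)"
    if "finite S" "hermitian_psd B" "\<And>k l. k \<notin> S \<Longrightarrow> B $ k $ l = 0" for S and B :: "complex^'n^'n"
    using that
  proof (induction S arbitrary: B rule: finite_induct)
    case empty
    then have "B = 0"
      by (simp add: vec_eq_iff)
    then show ?case
      by (simp add: trace_def)
  next
    case (insert i S)
    let ?C = "B - pivot_term i B"
    have "?C $ k $ l = 0" if "k \<notin> S" for k l
    proof (cases "k = i")
      case True
      then show ?thesis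
        using minus_pivot_term_row[OF insert.prems(1)] by blast
    next
      case False
      then show ?thesis
        \<comment> \<open>Rows that were zero stay zero: row \<open>k\<close> of the pivot term
          carries the factor \<open>B $ k $ i\<close>.\<close>
        using that insert.prems(2) by (simp add: pivot_term_def)
    qed
    then have "Re (trace (A ** ?C)) \<le> two_norm A * Re (trace ?C)"
      by (intro insert.IH hermitian_psd_minus_pivot_term insert.prems)
    moreover have "A ** ?C = A ** B - A ** pivot_term i B"
      by (simp add: matrix_matrix_mult_def vec_eq_iff right_diff_distrib sum_subtractf)
    ultimately show ?case
      using trace_mult_pivot_term_le[OF insert.prems(1), of A i]
      by (simp add: trace_sub right_diff_distrib)
  qed
  from this[of UNIV B] assms show ?thesis
    by simp
qed

section \<open>Multiplication by a nonsingular factor\<close>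

lemma matrix_inv_inverse:
  assumes "invertible A"
  shows "A ** matrix_inv A = mat 1 \<and> matrix_inv A ** A = mat 1"
  using assms unfolding invertible_def matrix_inv_def by (rule someI_ex)

lemma matrix_inv_mult_cancel:
  fixes A :: "complex^'m^'m"
  assumes "invertible A"
  shows "matrix_inv A ** (A ** B) = B"
  by (simp add: assms matrix_mul_assoc matrix_inv_inverse)

lemma invertible_matrix_inv:
  fixes A :: "complex^'m^'m"
  assumes "invertible A"
  shows "invertible (matrix_inv A)"
  using matrix_inv_inverse[OF assms] unfolding invertible_def by blast

lemma matrix_inv_matrix_inv:
  fixes A :: "complex^'m^'m"
  assumes "invertible A"
  shows "matrix_inv (matrix_inv A) = A"
proof -
  have "matrix_inv (matrix_inv A) ** (matrix_inv A ** A) = A"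
    by (rule matrix_inv_mult_cancel[OF invertible_matrix_inv[OF assms]])
  then show ?thesis
    by (simp add: matrix_inv_inverse[OF assms])
qed

lemma cond2_matrix_inv: "invertible A \<Longrightarrow> cond2 (matrix_inv A) = cond2 A"
  by (simp add: cond2_def matrix_inv_matrix_inv mult.commute)

lemma cond2_pos:
  fixes A :: "complex^'m^'m"
  assumes "invertible A"
  shows "0 < cond2 A"
proof -
  \<comment> \<open>If \<open>A\<close> or its inverse were zero, so would be their product, the
    identity.\<close>
  have "mat 1 \<noteq> (0 :: complex^'m^'m)"
    by (simp add: mat_def vec_eq_iff)
  then have "A \<noteq> 0" "matrix_inv A \<noteq> 0"
    using matrix_inv_inverse[OF assms] by auto
  then show ?thesis
    by (simp add: cond2_def two_norm_pos)
qed

text \<open>Ensures that the default value 0 of \<open>stable_rank\<close> and \<open>intdim\<close>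
  is taken for \<open>A ** B\<close> and for \<open>B\<close> simultaneously.\<close>

lemma invertible_mult_eq_0_iff:
  fixes A :: "complex^'m^'m" and B :: "complex^'n^'m"
  assumes "invertible A"
  shows "A ** B = 0 \<longleftrightarrow> B = 0"
  using matrix_inv_mult_cancel[OF assms, of B] by auto

lemma two_norm_le_mult:
  fixes A :: "complex^'m^'m" and B :: "complex^'n^'m"
  assumes "invertible A"
  shows "two_norm B \<le> two_norm (matrix_inv A) * two_norm (A ** B)"
  using two_norm_mult_le[of "matrix_inv A" "A ** B"] by (simp add: matrix_inv_mult_cancel[OF assms])

text \<open>The division step common to both upper bounds: \<open>a\<close>, \<open>b\<close> are
  the numerators for \<open>A ** B\<close> and \<open>B\<close>, and \<open>c\<close>,
  \<open>d\<close> the corresponding norms, squared in the case of the stable rank.\<close>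

lemma ratio_le:
  fixes a b c d p q :: real
  assumes "a \<le> p * b" "d \<le> q * c" "0 < c" "0 < d" "0 \<le> p" "0 \<le> b"
  shows "a / c \<le> p * q * (b / d)"
proof -
  have "a * d \<le> (p * b) * d"
    using assms by (intro mult_right_mono) auto
  also have "\<dots> \<le> (p * b) * (q * c)"
    using assms by (intro mult_left_mono) auto
  finally show ?thesis
    using assms by (simp add: field_simps)
qed

section \<open>The two upper bounds and the passage to the lower ones\<close>

lemma stable_rank_mult_le:
  fixes A :: "complex^'m^'m" and B :: "complex^'n^'m"
  assumes "invertible A"
  shows "stable_rank (A ** B) \<le> (cond2 A)\<^sup>2 * stable_rank B"
proof (cases "B = 0")
  case True
  then show ?thesis
    by (simp add: stable_rank_def)
next
  case False
  then have "A ** B \<noteq> 0"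
    by (simp add: invertible_mult_eq_0_iff[OF assms])
  have "(two_norm B)\<^sup>2 \<le> (two_norm (matrix_inv A))\<^sup>2 * (two_norm (A ** B))\<^sup>2"
    using power_mono[OF two_norm_le_mult[OF assms, of B] two_norm_nonneg, of 2]
    by (simp add: power_mult_distrib)
  then have "(frobenius_norm (A ** B))\<^sup>2 / (two_norm (A ** B))\<^sup>2 \<le>
      (two_norm A)\<^sup>2 * (two_norm (matrix_inv A))\<^sup>2 * ((frobenius_norm B)\<^sup>2 / (two_norm B)\<^sup>2)"
    by (intro ratio_le frobenius_norm_mult_le)
       (simp_all add: two_norm_eq_0_iff False \<open>A ** B \<noteq> 0\<close>)
  then show ?thesis
    using False \<open>A ** B \<noteq> 0\<close> by (simp add: stable_rank_def cond2_def power_mult_distrib)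
qed

text \<open>The first factor is a general invertible matrix, so that the lower bound can be obtained
  with \<open>matrix_inv A\<close> in its place.\<close>

lemma intdim_mult_le:
  fixes A B :: "complex^'n^'n"
  assumes "invertible A" "hermitian_psd B"
  shows "intdim (A ** B) \<le> cond2 A * intdim B"
proof (cases "B = 0")
  case True
  then show ?thesis
    by (simp add: intdim_def)
next
  case False
  then have "A ** B \<noteq> 0"
    by (simp add: invertible_mult_eq_0_iff[OF assms(1)])
  then have "Re (trace (A ** B)) / two_norm (A ** B) \<le>
      two_norm A * two_norm (matrix_inv A) * (Re (trace B) / two_norm B)"
    by (intro ratio_le trace_mult_hermitian_psd_le two_norm_le_mult assms
        two_norm_pos two_norm_nonneg hermitian_psd_trace_nonneg False)
  then show ?thesis
    using False \<open>A ** B \<noteq> 0\<close> by (simp add: intdim_def cond2_def)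
qed

text \<open>A nonzero kernel vector would make the quadratic form vanish; a square matrix with
  trivial kernel is invertible.\<close>

lemma hermitian_pd_invertible:
  fixes A :: "complex^'n^'n"
  assumes "hermitian_pd A"
  shows "invertible A"
proof -
  have "x = 0" if "A *v x = 0" for x
  proof (rule ccontr)
    assume "x \<noteq> 0"
    then have "0 < Re (quad_form A x)"
      using assms by (simp add: hermitian_pd_def)
    then show False
      using that by (simp add: quad_form_def)
  qed
  then show ?thesis
    using invertible_left_inverse matrix_left_invertible_ker by blast
qed

theorem corollary5p16:
  shows "(\<forall>(A :: complex^'m^'m) (B :: complex^'n^'m).
            invertible A \<longrightarrow>
              stable_rank B / (cond2 A)\<^sup>2 \<le> stable_rank (A ** B) \<and>
              stable_rank (A ** B) \<le> (cond2 A)\<^sup>2 * stable_rank B) \<and>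
         (\<forall>(A :: complex^'n^'n) (B :: complex^'n^'n).
            hermitian_pd A \<and> hermitian_psd B \<and> hermitian_psd (A ** B) \<longrightarrow>
              intdim B / cond2 A \<le> intdim (A ** B) \<and>
              intdim (A ** B) \<le> cond2 A * intdim B)"
proof (intro conjI allI impI)
  fix A :: "complex^'m^'m" and B :: "complex^'n^'m"
  assume inv: "invertible A"
  have "stable_rank B \<le> (cond2 A)\<^sup>2 * stable_rank (A ** B)"
    using stable_rank_mult_le[OF invertible_matrix_inv[OF inv], of "A ** B"]
    by (simp add: matrix_inv_mult_cancel cond2_matrix_inv inv)
  then show "stable_rank B / (cond2 A)\<^sup>2 \<le> stable_rank (A ** B)"
    using cond2_pos[OF inv] by (simp add: divide_le_eq mult.commute)
  show "stable_rank (A ** B) \<le> (cond2 A)\<^sup>2 * stable_rank B"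
    by (rule stable_rank_mult_le[OF inv])
next
  fix A B :: "complex^'n^'n"
  assume *: "hermitian_pd A \<and> hermitian_psd B \<and> hermitian_psd (A ** B)"
  then have inv: "invertible A"
    by (simp add: hermitian_pd_invertible)
  \<comment> \<open>Here \<open>A ** B\<close> is the positive semi-definite second factor, and
    multiplying it by \<open>matrix_inv A\<close> returns \<open>B\<close>.\<close>
  have "intdim B \<le> cond2 A * intdim (A ** B)"
    using intdim_mult_le[OF invertible_matrix_inv[OF inv], of "A ** B"] *
    by (simp add: matrix_inv_mult_cancel cond2_matrix_inv inv)
  then show "intdim B / cond2 A \<le> intdim (A ** B)"
    using cond2_pos[OF inv] by (simp add: divide_le_eq mult.commute)
  show "intdim (A ** B) \<le> cond2 A * intdim B"
    using intdim_mult_le[OF inv] * by blast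
qed

end
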